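(* There exists a connected graph $G$ of bounded maximum degree with countably many ends which is not reconstructible; that is, there is a graph $H$ that is hypomorphic to $G$ but not isomorphic to $G$.
   Context: Two graphs $G$ and $H$ are hypomorphic if there is a bijection $\varphi\colon V(G)\to V(H)$ such that $G-v\cong H-\varphi(v)$ for every $v\in V(G)$. A graph $G$ is reconstructible if every graph hypomorphic to $G$ is isomorphic to $G$. A ray is a one-way infinite path; two rays are equivalent if for every finite vertex set $S$ they have tails in the same component of $G-S$; an end is an equivalence class of rays. *)

theory Defs
  imports Main "HOL-Library.Countable_Set"
begin

record 'a ugraph =
  verts :: "'a set"
  edges :: "'a set set"

definition simple_graph :: "'a ugraph \<Rightarrow> bool" where
  "simple_graph G \<longleftrightarrow> (\<forall>e\<in>edges G. e \<subseteq> verts G \<and> card e = 2)"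

definition adj :: "'a ugraph \<Rightarrow> 'a \<Rightarrow> 'a \<Rightarrow> bool" where
  "adj G u v \<longleftrightarrow> {u, v} \<in> edges G"

definition delete_verts :: "'a ugraph \<Rightarrow> 'a set \<Rightarrow> 'a ugraph" where
  "delete_verts G S = \<lparr>verts = verts G - S, edges = {e \<in> edges G. e \<inter> S = {}}\<rparr>"

definition graph_iso :: "'a ugraph \<Rightarrow> 'b ugraph \<Rightarrow> bool" where
  "graph_iso G H \<longleftrightarrow> (\<exists>f. bij_betw f (verts G) (verts H) \<and>
     (\<forall>u\<in>verts G. \<forall>v\<in>verts G. adj G u v \<longleftrightarrow> adj H (f u) (f v)))"

definition hypomorphic :: "'a ugraph \<Rightarrow> 'b ugraph \<Rightarrow> bool" where
  "hypomorphic G H \<longleftrightarrow> (\<exists>\<phi>. bij_betw \<phi> (verts G) (verts H) \<and>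
     (\<forall>v\<in>verts G. graph_iso (delete_verts G {v}) (delete_verts H {\<phi> v})))"

text \<open>Letting \<open>H\<close> range over graphs with the same vertex type loses nothing: hypomorphic graphs have
  equinumerous vertex sets, so every graph hypomorphic to \<open>G\<close> has an isomorphic copy on
  \<open>verts G\<close>, and both notions are invariant under isomorphism.\<close>
definition reconstructible :: "'a ugraph \<Rightarrow> bool" where
  "reconstructible G \<longleftrightarrow>
     (\<forall>H :: 'a ugraph. simple_graph H \<and> hypomorphic G H \<longrightarrow> graph_iso G H)"

definition component_of :: "'a ugraph \<Rightarrow> 'a \<Rightarrow> 'a set" where
  "component_of G v = {u. (adj G)\<^sup>*\<^sup>* v u}"

definition components :: "'a ugraph \<Rightarrow> 'a set set" where
  "components G = component_of G ` verts G"

definition connected_graph :: "'a ugraph \<Rightarrow> bool" where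
  "connected_graph G \<longleftrightarrow> verts G \<noteq> {} \<and> (\<forall>u\<in>verts G. \<forall>v\<in>verts G. (adj G)\<^sup>*\<^sup>* u v)"

definition bounded_degree :: "'a ugraph \<Rightarrow> bool" where
  "bounded_degree G \<longleftrightarrow> (\<exists>d. \<forall>v\<in>verts G. finite {u. adj G v u} \<and> card {u. adj G v u} \<le> d)"

text \<open>A ray is encoded as the injective sequence of its vertices, listed from its unique vertex of
  degree one.\<close>
definition ray :: "'a ugraph \<Rightarrow> (nat \<Rightarrow> 'a) \<Rightarrow> bool" where
  "ray G r \<longleftrightarrow> inj r \<and> range r \<subseteq> verts G \<and> (\<forall>n. adj G (r n) (r (Suc n)))"

definition equivalent_rays :: "'a ugraph \<Rightarrow> (nat \<Rightarrow> 'a) \<Rightarrow> (nat \<Rightarrow> 'a) \<Rightarrow> bool" where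
  "equivalent_rays G r s \<longleftrightarrow> (\<forall>S. finite S \<and> S \<subseteq> verts G \<longrightarrow>
     (\<exists>C\<in>components (delete_verts G S). \<exists>m n. r ` {m..} \<subseteq> C \<and> s ` {n..} \<subseteq> C))"

definition ray_equiv :: "'a ugraph \<Rightarrow> ((nat \<Rightarrow> 'a) \<times> (nat \<Rightarrow> 'a)) set" where
  "ray_equiv G = {(r, s). ray G r \<and> ray G s \<and> equivalent_rays G r s}"

definition ends :: "'a ugraph \<Rightarrow> (nat \<Rightarrow> 'a) set set" where
  "ends G = {r. ray G r} // ray_equiv G"

lemma component_of_eq:
  assumes "u \<in> component_of G v"
  shows "component_of G u = component_of G v"
proof -
  have "symp (adj G)"
    by (simp add: symp_def adj_def insert_commute)
  hence "symp (adj G)\<^sup>*\<^sup>*"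
    by (rule symp_rtranclp)
  moreover have vu: "(adj G)\<^sup>*\<^sup>* v u"
    using assms by (simp add: component_of_def)
  ultimately have uv: "(adj G)\<^sup>*\<^sup>* u v"
    by (rule sympD)
  show ?thesis
    using rtranclp_trans[OF uv] rtranclp_trans[OF vu] unfolding component_of_def by blast
qed

lemma equivalent_raysI:
  assumes "\<And>S. finite S \<Longrightarrow> S \<subseteq> verts G \<Longrightarrow>
    \<exists>C m n. C \<in> components (delete_verts G S) \<and> r ` {m..} \<subseteq> C \<and> s ` {n..} \<subseteq> C"
  shows "equivalent_rays G r s"
  unfolding equivalent_rays_def Bex_def using assms by metis

lemma equivalent_raysE:
  assumes "equivalent_rays G r s" "finite S" "S \<subseteq> verts G"
  obtains C m n where "C \<in> components (delete_verts G S)" "r ` {m..} \<subseteq> C" "s ` {n..} \<subseteq> C"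
  using assms(1)[unfolded equivalent_rays_def, rule_format, OF conjI, OF assms(2,3)] by metis

lemma equivalent_rays_refl:
  assumes r: "ray G r"
  shows "equivalent_rays G r r"
proof (rule equivalent_raysI)
  fix S :: "'a set" assume "finite S"
  hence "finite (r -` S)"
    using r by (simp add: ray_def finite_vimageI)
  then obtain m where m: "\<And>i. i \<in> r -` S \<Longrightarrow> i < m"
    unfolding finite_nat_set_iff_bounded by blast
  hence notin: "r (m + i) \<notin> S" for i
    using m[of "m + i"] by auto
  have reach: "(adj (delete_verts G S))\<^sup>*\<^sup>* (r m) (r (m + i))" for i
  proof (induction i)
    case 0
    show ?case by simp
  next
    case (Suc i)
    have "adj G (r (m + i)) (r (m + Suc i))"
      using r by (simp add: ray_def)
    hence "adj (delete_verts G S) (r (m + i)) (r (m + Suc i))"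
      using notin[of i] notin[of "Suc i"] by (simp add: adj_def delete_verts_def)
    with Suc show ?case
      by (rule rtranclp.rtrancl_into_rtrancl)
  qed
  have "r ` {m..} \<subseteq> component_of (delete_verts G S) (r m)"
  proof (rule image_subsetI)
    fix i assume "i \<in> {m..}"
    thus "r i \<in> component_of (delete_verts G S) (r m)"
      using reach[of "i - m"] by (simp add: component_of_def)
  qed
  moreover have "r m \<in> verts (delete_verts G S)"
    using notin[of 0] r by (simp add: ray_def delete_verts_def image_subset_iff)
  ultimately show "\<exists>C m n. C \<in> components (delete_verts G S) \<and> r ` {m..} \<subseteq> C \<and> r ` {n..} \<subseteq> C"
    unfolding components_def by (metis imageI)
qed

lemma equivalent_rays_sym:
  assumes "equivalent_rays G r s"
  shows "equivalent_rays G s r"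
proof (rule equivalent_raysI)
  fix S assume "finite S" "S \<subseteq> verts G"
  with assms show "\<exists>C m n. C \<in> components (delete_verts G S) \<and> s ` {m..} \<subseteq> C \<and> r ` {n..} \<subseteq> C"
    by (rule equivalent_raysE) metis
qed

lemma equivalent_rays_trans:
  assumes "equivalent_rays G r s" "equivalent_rays G s t"
  shows "equivalent_rays G r t"
proof (rule equivalent_raysI)
  fix S assume S: "finite S" "S \<subseteq> verts G"
  obtain C m n where C: "C \<in> components (delete_verts G S)" "r ` {m..} \<subseteq> C" "s ` {n..} \<subseteq> C"
    using equivalent_raysE[OF assms(1) S] .
  obtain D k l where D: "D \<in> components (delete_verts G S)" "s ` {k..} \<subseteq> D" "t ` {l..} \<subseteq> D"
    using equivalent_raysE[OF assms(2) S] .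
  have "s (max n k) \<in> C" "s (max n k) \<in> D"
    using C(3) D(2) by (simp_all add: image_subset_iff)
  hence "C = D"
    using C(1) D(1) unfolding components_def by (metis component_of_eq imageE)
  with C D show "\<exists>C m n. C \<in> components (delete_verts G S) \<and> r ` {m..} \<subseteq> C \<and> t ` {n..} \<subseteq> C"
    by metis
qed

lemma equiv_ray_equiv: "equiv {r. ray G r} (ray_equiv G)"
proof (rule equivI)
  show "ray_equiv G \<subseteq> {r. ray G r} \<times> {r. ray G r}"
    by (auto simp: ray_equiv_def)
  show "refl_on {r. ray G r} (ray_equiv G)"
    by (simp add: refl_on_def ray_equiv_def equivalent_rays_refl)
  show "sym (ray_equiv G)"
    by (rule symI) (simp add: ray_equiv_def equivalent_rays_sym)
  show "trans (ray_equiv G)"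
    by (rule transI) (auto simp: ray_equiv_def intro: equivalent_rays_trans)
qed

end

theory Submission
  imports Defs
begin

text \<open>Let \<open>D\<close> be the free product of countably many groups of order two, realised as lists
  without equal neighbours. Each \<open>w \<in> D\<close> carries a two-way infinite spine with a twig at every
  level; at nonnegative levels the spines of \<open>w\<close> and \<open>w a\<^sub>l\<close> are joined by infinitely many edges for
  each generator \<open>a\<^sub>l\<close>, so these halves form a single end, while every negative half is an end of its
  own. A colouring \<open>c\<close> of \<open>D \<times> \<int>\<close> decides whether an extra edge joins the spine vertex and the twig
  vertex at \<open>(w, n)\<close>. These potential edges match all vertices in pairs, so deleting a vertex erases
  exactly one bit of the colouring.

  Since the Cayley graph of \<open>D\<close> is a tree, there are colourings \<open>c\<^sub>0\<close> and \<open>c\<^sub>1\<close> such that \<open>c\<^sub>0\<close> and the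
  left translate of \<open>c\<^sub>1\<close> by \<open>a\<^sub>m\<close> differ in exactly one place \<open>e\<^sub>m\<close>, where the places \<open>e\<^sub>m\<close> can be
  prescribed; this gives hypomorphic graphs. Every isomorphism between the two graphs is a
  left translation. Translation by a word of odd length changes \<open>c\<^sub>0\<close> into \<open>c\<^sub>1\<close> up to an odd number of
  places, and translation by a word of even length changes \<open>c\<^sub>1\<close> into itself up to finitely many places,
  whereas \<open>c\<^sub>0\<close> and \<open>c\<^sub>1\<close> differ at all places \<open>(1, n)\<close>. So the graphs are not isomorphic.\<close>

subsection \<open>The free product of groups of order two\<close>

text \<open>Left multiplication by the generator \<open>m\<close>, with cancellation. Group elements
  are the reduced words, that is, the lists satisfying \<open>distinct_adj\<close>.\<close>

definition lmul :: "nat \<Rightarrow> nat list \<Rightarrow> nat list" where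
  "lmul m w = (if w \<noteq> [] \<and> hd w = m then tl w else m # w)"

definition rmul :: "nat \<Rightarrow> nat list \<Rightarrow> nat list" where
  "rmul l w = rev (lmul l (rev w))"

lemma lmul_simps [simp]:
  "lmul m [] = [m]" "lmul m (a # w) = (if a = m then w else m # a # w)"
  by (auto simp: lmul_def)

lemma distinct_adj_lmul [simp]: "distinct_adj w \<Longrightarrow> distinct_adj (lmul m w)"
  by (cases w) (auto simp: distinct_adj_Cons)

lemma lmul_lmul [simp]: "distinct_adj w \<Longrightarrow> lmul m (lmul m w) = w"
  by (cases w; cases "tl w") auto

lemma distinct_adj_rmul [simp]: "distinct_adj w \<Longrightarrow> distinct_adj (rmul l w)"
  by (simp add: rmul_def)

lemma rmul_rmul [simp]: "distinct_adj w \<Longrightarrow> rmul l (rmul l w) = w"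
  by (simp add: rmul_def)

text \<open>A letter is added or cancelled, so the length changes. Hence the edges between different
  spines are never loops.\<close>

lemma rmul_neq [simp]: "rmul l w \<noteq> w" "w \<noteq> rmul l w"
proof -
  have "length (lmul l v) \<noteq> length v" for v
    by (cases v) auto
  hence "length (rmul l w) \<noteq> length w"
    by (metis length_rev rmul_def)
  thus "rmul l w \<noteq> w" "w \<noteq> rmul l w"
    by metis+
qed

lemma rmul_snoc: "rmul l (w @ [a]) = (if a = l then w else w @ [a, l])"
  by (simp add: rmul_def)

lemma rmul_Nil [simp]: "rmul l [] = [l]"
  by (simp add: rmul_def)

lemma rmul_append_letter: "distinct_adj (w @ [l]) \<Longrightarrow> rmul l w = w @ [l]"
  by (cases w rule: rev_cases) (auto simp: rmul_snoc distinct_adj_append_iff)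

text \<open>This is associativity: the two multiplications act at opposite ends, and only words of
  length at most one let them meet. It is why left translations respect the edges between
  spines.\<close>

lemma lmul_rmul: "lmul m (rmul l w) = rmul l (lmul m w)"
proof (cases w rule: rev_cases)
  case Nil
  thus ?thesis by (simp add: rmul_def)
next
  case (snoc u a)
  show ?thesis
  proof (cases u)
    case Nil
    thus ?thesis using snoc by (simp add: rmul_def)
  next
    case (Cons b v)
    have "rmul l (v @ [a]) = (if a = l then v else v @ [a, l])"
      "rmul l (b # v @ [a]) = (if a = l then b # v else b # v @ [a, l])"
      "rmul l (m # b # v @ [a]) = (if a = l then m # b # v else m # b # v @ [a, l])"
      by (simp_all add: rmul_def)
    thus ?thesis using snoc Cons by simp
  qed
qed

subsection \<open>The graph of a colouring\<close>

definition spine :: "nat list \<Rightarrow> int \<Rightarrow> nat" where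
  "spine w n = to_nat (w, n, False)"

definition twig :: "nat list \<Rightarrow> int \<Rightarrow> nat" where
  "twig w n = to_nat (w, n, True)"

lemma spine_twig_inject [simp]:
  "spine w n = spine w' n' \<longleftrightarrow> w = w' \<and> n = n'"
  "twig w n = twig w' n' \<longleftrightarrow> w = w' \<and> n = n'"
  "spine w n \<noteq> twig w' n'" "twig w n \<noteq> spine w' n'"
  by (auto simp: spine_def twig_def)

text \<open>Each nonnegative level serves a single generator, so degrees stay bounded despite
  infinitely many generators. Each generator recurs at arbitrarily high levels, so no finite set
  blocks all its edges.\<close>

definition gate :: "int \<Rightarrow> nat" where
  "gate n = fst (prod_decode (nat n))"

lemma gate_cofinal: "\<exists>n\<ge>N. 0 \<le> n \<and> gate n = l"
proof -
  have "gate (int (prod_encode (l, nat N))) = l"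
    by (simp add: gate_def)
  moreover have "N \<le> int (prod_encode (l, nat N))"
    using le_prod_encode_2[of "nat N" l] by linarith
  ultimately show ?thesis
    by force
qed

text \<open>The twig of level \<open>n\<close> hangs from the spine at level \<open>n + 1\<close>;
  the pair at level \<open>n\<close> is thereby left free for the colour edge.\<close>

definition colgraph :: "(nat list \<Rightarrow> int \<Rightarrow> bool) \<Rightarrow> nat ugraph" where
  "colgraph c = \<lparr>
     verts = {spine w n | w n. distinct_adj w} \<union> {twig w n | w n. distinct_adj w},
     edges = {{spine w n, spine w (n + 1)} | w n. distinct_adj w}
       \<union> {{spine w n, spine (rmul (gate n) w) n} | w n. distinct_adj w \<and> 0 \<le> n}
       \<union> {{spine w (n + 1), twig w n} | w n. distinct_adj w}
       \<union> {{spine w n, twig w n} | w n. distinct_adj w \<and> c w n}\<rparr>"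

lemma verts_colgraph [simp]:
  "spine w n \<in> verts (colgraph c) \<longleftrightarrow> distinct_adj w"
  "twig w n \<in> verts (colgraph c) \<longleftrightarrow> distinct_adj w"
  by (auto simp: colgraph_def)

lemma verts_colgraphE:
  assumes "v \<in> verts (colgraph c)"
  obtains w n where "distinct_adj w" "v = spine w n" | w n where "distinct_adj w" "v = twig w n"
  using assms by (auto simp: colgraph_def)

lemma adj_sym: "adj G u v \<longleftrightarrow> adj G v u"
  by (simp add: adj_def insert_commute)

lemma adj_spine_spine [simp]:
  "adj (colgraph c) (spine w n) (spine w' n') \<longleftrightarrow> distinct_adj w \<and> distinct_adj w' \<and>
     (w' = w \<and> (n' = n + 1 \<or> n = n' + 1) \<or> n' = n \<and> 0 \<le> n \<and> w' = rmul (gate n) w)"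
  unfolding adj_def colgraph_def by (auto simp: doubleton_eq_iff)

lemma adj_spine_twig [simp]:
  "adj (colgraph c) (spine w n) (twig w' n') \<longleftrightarrow> distinct_adj w \<and> w' = w \<and>
     (n = n' + 1 \<or> n' = n \<and> c w n)"
  unfolding adj_def colgraph_def by (auto simp: doubleton_eq_iff)

lemma adj_twig_spine [simp]:
  "adj (colgraph c) (twig w' n') (spine w n) \<longleftrightarrow> distinct_adj w \<and> w' = w \<and>
     (n = n' + 1 \<or> n' = n \<and> c w n)"
  by (subst adj_sym) simp

lemma adj_twig_twig [simp]: "\<not> adj (colgraph c) (twig w n) (twig w' n')"
  unfolding adj_def colgraph_def by (auto simp: doubleton_eq_iff)

lemma adj_colgraph_verts: "adj (colgraph c) u v \<Longrightarrow> u \<in> verts (colgraph c) \<and> v \<in> verts (colgraph c)"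
  unfolding adj_def colgraph_def by (auto simp: doubleton_eq_iff)

lemma simple_graph_colgraph: "simple_graph (colgraph c)"
  unfolding simple_graph_def colgraph_def by auto

lemma bounded_degree_colgraph: "bounded_degree (colgraph c)"
  unfolding bounded_degree_def
proof (intro exI ballI)
  fix v assume v: "v \<in> verts (colgraph c)"
  obtain w n where wn: "v = spine w n \<or> v = twig w n"
    using v by (auto elim: verts_colgraphE)
  \<comment> \<open>One list serves both kinds of vertex: a twig can only see
    \<open>spine w n\<close> and \<open>spine w (n + 1)\<close>.\<close>
  let ?L = "[spine w (n - 1), spine w n, spine w (n + 1), spine (rmul (gate n) w) n,
    twig w (n - 1), twig w n]"
  have sub: "{u. adj (colgraph c) v u} \<subseteq> set ?L"
  proof
    fix u assume "u \<in> {u. adj (colgraph c) v u}"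
    hence a: "adj (colgraph c) v u" by simp
    hence "u \<in> verts (colgraph c)"
      using adj_colgraph_verts by blast
    thus "u \<in> set ?L"
      by (rule verts_colgraphE) (use wn a in auto)
  qed
  have "card (set ?L) \<le> 6"
    using card_length[of ?L] by simp
  moreover have "card {u. adj (colgraph c) v u} \<le> card (set ?L)"
    using sub by (intro card_mono) auto
  ultimately show "finite {u. adj (colgraph c) v u} \<and> card {u. adj (colgraph c) v u} \<le> 6"
    using finite_subset[OF sub] by simp
qed

section \<open>Reachability after deleting vertices, and connectedness\<close>

lemma adj_delete_verts:
  "adj (delete_verts G S) u v \<longleftrightarrow> adj G u v \<and> u \<notin> S \<and> v \<notin> S"
  by (auto simp: adj_def delete_verts_def)

lemma verts_delete_verts [simp]: "verts (delete_verts G S) = verts G - S"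
  by (simp add: delete_verts_def)

lemma rtranclp_adj_sym: "(adj G)\<^sup>*\<^sup>* u v \<Longrightarrow> (adj G)\<^sup>*\<^sup>* v u"
  by (metis adj_sym sympD sympI symp_rtranclp)

lemma spine_reach:
  assumes "distinct_adj w" "n \<le> n'" "\<And>i. n \<le> i \<Longrightarrow> i \<le> n' \<Longrightarrow> spine w i \<notin> S"
  shows "(adj (delete_verts (colgraph c) S))\<^sup>*\<^sup>* (spine w n) (spine w n')"
  using assms(2,3)
proof (induction n' rule: int_ge_induct)
  case base
  show ?case by simp
next
  case (step i)
  have "(adj (delete_verts (colgraph c) S))\<^sup>*\<^sup>* (spine w n) (spine w i)"
    by (rule step.IH) (use step.prems in auto)
  moreover have "adj (delete_verts (colgraph c) S) (spine w i) (spine w (i + 1))"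
    using step assms(1) by (simp add: adj_delete_verts)
  ultimately show ?case
    by (rule rtranclp.rtrancl_into_rtrancl)
qed

text \<open>Spell \<open>w\<close> letter by letter: climb the current spine to a level whose gate
  is the next letter, cross there, and descend to \<open>N\<close>. The walk never goes below
  \<open>N\<close>, so it misses \<open>S\<close>.\<close>

lemma high_spine_reach:
  assumes N: "\<And>w n. N \<le> n \<Longrightarrow> spine w n \<notin> S" and "0 \<le> N" and "distinct_adj w"
  shows "(adj (delete_verts (colgraph c) S))\<^sup>*\<^sup>* (spine [] N) (spine w N)"
  using \<open>distinct_adj w\<close>
proof (induction w rule: rev_induct)
  case Nil
  show ?case by simp
next
  case (snoc l w)
  let ?R = "(adj (delete_verts (colgraph c) S))\<^sup>*\<^sup>*"
  have w: "distinct_adj w"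
    using snoc.prems by (simp add: distinct_adj_append_iff)
  obtain n where n: "N \<le> n" "gate n = l"
    using gate_cofinal by blast
  have "?R (spine [] N) (spine w N)"
    using snoc.IH w by simp
  also have "?R (spine w N) (spine w n)"
    using N n w by (intro spine_reach) auto
  also have "?R (spine w n) (spine (w @ [l]) n)"
    using N n \<open>0 \<le> N\<close> w snoc.prems by (intro r_into_rtranclp) (simp add: rmul_append_letter adj_delete_verts)
  also have "?R (spine (w @ [l]) n) (spine (w @ [l]) N)"
    using N n snoc.prems by (intro rtranclp_adj_sym[OF spine_reach]) auto
  finally show ?case .
qed

lemma connected_colgraph: "connected_graph (colgraph c)"
proof -
  let ?R = "(adj (colgraph c))\<^sup>*\<^sup>*"
  have del: "delete_verts (colgraph c) {} = colgraph c"
    by (simp add: delete_verts_def)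
  have sp: "?R (spine [] 0) (spine w n)" if w: "distinct_adj w" for w n
  proof -
    have "?R (spine [] 0) (spine w 0)"
      using high_spine_reach[of 0 "{}" w c] w by (simp add: del)
    also have "?R (spine w 0) (spine w n)"
      using spine_reach[of w 0 n "{}" c] rtranclp_adj_sym[OF spine_reach[of w n 0 "{}" c]] w
      by (cases "0 \<le> n") (simp_all add: del)
    finally show ?thesis .
  qed
  have "?R (spine [] 0) v" if "v \<in> verts (colgraph c)" for v
    using that
  proof (cases rule: verts_colgraphE)
    case (1 w n)
    thus ?thesis using sp by simp
  next
    case (2 w n)
    have "?R (spine [] 0) (spine w (n + 1))"
      using sp 2 by simp
    moreover have "adj (colgraph c) (spine w (n + 1)) v"
      using 2 by simp
    ultimately show ?thesis
      by (rule rtranclp.rtrancl_into_rtrancl)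
  qed
  hence "\<forall>u\<in>verts (colgraph c). \<forall>v\<in>verts (colgraph c). ?R u v"
    by (meson rtranclp_adj_sym rtranclp_trans)
  moreover have "spine [] 0 \<in> verts (colgraph c)"
    by simp
  ultimately show ?thesis
    unfolding connected_graph_def by blast
qed

subsection \<open>Ends\<close>

lemma ray_tail_avoids:
  assumes "ray G r" "finite F"
  obtains m where "\<And>j. m \<le> j \<Longrightarrow> r j \<notin> F"
proof -
  have "finite (r -` F)"
    using assms by (simp add: ray_def finite_vimageI)
  then obtain m where "\<And>i. i \<in> r -` F \<Longrightarrow> i < m"
    unfolding finite_nat_set_iff_bounded by blast
  hence "r j \<notin> F" if "m \<le> j" for j
    using that by (meson leD vimageI)
  thus ?thesis ..
qed

lemma ray_tail_reach:
  assumes r: "ray G r" and av: "\<And>j. m \<le> j \<Longrightarrow> r j \<notin> S" and "m \<le> j"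
  shows "(adj (delete_verts G S))\<^sup>*\<^sup>* (r m) (r j)"
  using \<open>m \<le> j\<close>
proof (induction j rule: dec_induct)
  case base
  show ?case by simp
next
  case (step j)
  have "adj (delete_verts G S) (r j) (r (Suc j))"
    using r av step by (simp add: ray_def adj_delete_verts)
  with step.IH show ?case
    by (rule rtranclp.rtrancl_into_rtrancl)
qed

text \<open>The vertex \<open>z\<close> names the required component: a tail that avoids
  \<open>S\<close> and starts in this component stays in it.\<close>

lemma equivalent_rays_reachI:
  fixes r s :: "nat \<Rightarrow> 'a"
  assumes "ray G r" "ray G s"
    and reach: "\<And>S. finite S \<Longrightarrow> \<exists>z\<in>verts G - S. \<exists>m n.
      (\<forall>j\<ge>m. r j \<notin> S) \<and> (\<forall>j\<ge>n. s j \<notin> S) \<and>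
      (adj (delete_verts G S))\<^sup>*\<^sup>* z (r m) \<and> (adj (delete_verts G S))\<^sup>*\<^sup>* z (s n)"
  shows "equivalent_rays G r s"
proof (rule equivalent_raysI)
  fix S :: "'a set" assume "finite S"
  then obtain z m n where z: "z \<in> verts G - S" "\<And>j. m \<le> j \<Longrightarrow> r j \<notin> S" "\<And>j. n \<le> j \<Longrightarrow> s j \<notin> S"
    "(adj (delete_verts G S))\<^sup>*\<^sup>* z (r m)" "(adj (delete_verts G S))\<^sup>*\<^sup>* z (s n)"
    using reach[of S] by blast
  let ?C = "component_of (delete_verts G S) z"
  have "?C \<in> components (delete_verts G S)"
    using z(1) by (simp add: components_def)
  moreover have "r ` {m..} \<subseteq> ?C"
    using rtranclp_trans[OF z(4) ray_tail_reach[OF assms(1) z(2)]] by (auto simp: component_of_def)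
  moreover have "s ` {n..} \<subseteq> ?C"
    using rtranclp_trans[OF z(5) ray_tail_reach[OF assms(2) z(3)]] by (auto simp: component_of_def)
  ultimately show "\<exists>C m n. C \<in> components (delete_verts G S) \<and> r ` {m..} \<subseteq> C \<and> s ` {n..} \<subseteq> C"
    by blast
qed

definition hair :: "nat list \<Rightarrow> nat set" where
  "hair w = {spine w n | n. n < 0} \<union> {twig w n | n. n < 0}"

lemma hair_simps [simp]:
  "spine w' n \<in> hair w \<longleftrightarrow> w' = w \<and> n < 0" "twig w' n \<in> hair w \<longleftrightarrow> w' = w \<and> n < 0"
  by (auto simp: hair_def)

text \<open>The only outlet of a hair is \<open>spine w 0\<close>: edges to other spines need a
  nonnegative level, and the twig of level -1 hangs from \<open>spine w 0\<close>.\<close>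

lemma hair_exit:
  assumes "u \<in> hair w" "adj (colgraph c) u v" "v \<noteq> spine w 0"
  shows "v \<in> hair w"
proof -
  have "v \<in> verts (colgraph c)"
    using assms(2) adj_colgraph_verts by blast
  thus ?thesis
  proof (cases rule: verts_colgraphE)
    case (1 w' n')
    thus ?thesis
      using assms by (auto simp: hair_def)
  next
    case (2 w' n')
    thus ?thesis
      using assms by (auto simp: hair_def)
  qed
qed

definition main_ray :: "nat \<Rightarrow> nat" where
  "main_ray i = spine [] (int i)"

text \<open>Starting at level -1 puts the whole ray inside \<open>hair w\<close>.\<close>

definition hair_ray :: "nat list \<Rightarrow> nat \<Rightarrow> nat" where
  "hair_ray w i = spine w (- 1 - int i)"

lemma ray_main_ray: "ray (colgraph c) main_ray"
  by (auto simp: ray_def main_ray_def inj_def)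

lemma ray_hair_ray: "distinct_adj w \<Longrightarrow> ray (colgraph c) (hair_ray w)"
  by (auto simp: ray_def hair_ray_def inj_def)

lemma finite_spine_levels:
  assumes "finite S"
  obtains N where "0 \<le> N" "\<And>w n. N \<le> \<bar>n\<bar> \<Longrightarrow> spine w n \<notin> S"
proof -
  define A where "A = (\<lambda>(w :: nat list, n :: int, b :: bool). \<bar>n\<bar>) ` from_nat ` S"
  have fin: "finite A"
    using assms by (simp add: A_def)
  have A: "\<bar>n\<bar> \<in> A" if "spine w n \<in> S" for w n
    unfolding A_def image_image by (rule image_eqI[OF _ that]) (simp add: spine_def)
  have "spine w n \<notin> S" if "Max (insert 0 A) + 1 \<le> \<bar>n\<bar>" for w n
  proof
    assume "spine w n \<in> S"
    hence "\<bar>n\<bar> \<le> Max (insert 0 A)"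
      using A fin by (intro Max_ge) auto
    thus False
      using that by simp
  qed
  moreover have "0 \<le> Max (insert 0 A)"
    using fin by (intro Max_ge) auto
  ultimately show ?thesis
    using that[of "Max (insert 0 A) + 1"] by force
qed

text \<open>Outside the hairs, deleting \<open>S\<close> cuts off only finitely many vertices. A
  spine whose word does not occur in \<open>S\<close> can be descended to level 0; on the finitely
  many others only levels below \<open>N\<close> are in doubt, and these make up
  \<open>F\<close>.\<close>

lemma high_vertex_reach:
  assumes "finite S"
  obtains N F where "0 \<le> N" "\<And>w n. N \<le> n \<Longrightarrow> spine w n \<notin> S" "finite F"
    "\<And>v. v \<in> verts (colgraph c) \<Longrightarrow> (\<forall>w. v \<notin> hair w) \<Longrightarrow> v \<notin> F \<Longrightarrow> v \<notin> S \<Longrightarrow>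
       (adj (delete_verts (colgraph c) S))\<^sup>*\<^sup>* (spine [] N) v"
proof -
  let ?R = "(adj (delete_verts (colgraph c) S))\<^sup>*\<^sup>*"
  obtain N where N: "0 \<le> N" "\<And>w n. N \<le> \<bar>n\<bar> \<Longrightarrow> spine w n \<notin> S"
    using finite_spine_levels[OF assms] by blast
  have N': "\<And>w n. N \<le> n \<Longrightarrow> spine w n \<notin> S"
    using N by force
  define W where "W = (\<lambda>(w :: nat list, n :: int, b :: bool). w) ` from_nat ` S"
  have W: "w \<in> W" if "spine w n \<in> S" for w n
    unfolding W_def image_image by (rule image_eqI[OF _ that]) (simp add: spine_def)
  define F where "F = (\<lambda>(w, n). spine w n) ` (W \<times> {0..<N}) \<union> (\<lambda>(w, n). twig w n) ` (W \<times> {0..<N})"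
  have "finite F"
    using assms by (simp add: F_def W_def)
  have sp: "?R (spine [] N) (spine w n)" if w: "distinct_adj w" and n: "0 \<le> n" "w \<notin> W \<or> N \<le> n" for w n
  proof -
    have "?R (spine [] N) (spine w N)"
      using high_spine_reach[OF N' N(1) w] .
    also have "?R (spine w N) (spine w n)"
    proof (cases "N \<le> n")
      case True
      thus ?thesis
        using N' w by (intro spine_reach) auto
    next
      case False
      thus ?thesis
        using W n w by (intro rtranclp_adj_sym[OF spine_reach]) auto
    qed
    finally show ?thesis .
  qed
  have "?R (spine [] N) v"
    if v: "v \<in> verts (colgraph c)" "\<forall>w. v \<notin> hair w" "v \<notin> F" "v \<notin> S" for v
    using v(1)
  proof (cases rule: verts_colgraphE)
    case (1 w n)
    hence "w \<notin> W \<or> N \<le> n" "0 \<le> n"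
      using v by (force simp: F_def)+
    thus ?thesis
      using 1 sp by simp
  next
    case (2 w n)
    hence n: "w \<notin> W \<or> N \<le> n" "0 \<le> n"
      using v by (force simp: F_def)+
    hence "?R (spine [] N) (spine w (n + 1))"
      using 2 by (intro sp) auto
    moreover have "spine w (n + 1) \<notin> S"
      using n W N'[of "n + 1" w] by auto
    hence "adj (delete_verts (colgraph c) S) (spine w (n + 1)) v"
      using 2 v(4) by (simp add: adj_delete_verts)
    ultimately show ?thesis
      by (rule rtranclp.rtrancl_into_rtrancl)
  qed
  with N(1) N' \<open>finite F\<close> show ?thesis
    by (rule that)
qed

text \<open>Once past \<open>F\<close> and \<open>S\<close>, the ray still meets a vertex outside
  all hairs, and this vertex is joined to the high part. Otherwise it would be trapped in a single
  hair, since leaving one means passing \<open>spine w 0\<close>, which lies in no hair.\<close>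

lemma equivalent_main_ray:
  assumes r: "ray (colgraph c) r" and out: "\<And>w m. \<exists>j\<ge>m. r j \<notin> hair w"
  shows "equivalent_rays (colgraph c) r main_ray"
proof (rule equivalent_rays_reachI[OF r ray_main_ray])
  fix S :: "nat set" assume S: "finite S"
  let ?R = "(adj (delete_verts (colgraph c) S))\<^sup>*\<^sup>*"
  obtain N F where N: "0 \<le> N" "\<And>w n. N \<le> n \<Longrightarrow> spine w n \<notin> S" and F: "finite F"
    "\<And>v. v \<in> verts (colgraph c) \<Longrightarrow> \<forall>w. v \<notin> hair w \<Longrightarrow> v \<notin> F \<Longrightarrow> v \<notin> S \<Longrightarrow> ?R (spine [] N) v"
    using high_vertex_reach[OF S, of c] by metis
  obtain m where m: "\<And>j. m \<le> j \<Longrightarrow> r j \<notin> F \<union> S"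
    using ray_tail_avoids[OF r, of "F \<union> S"] F(1) S by blast
  have "\<exists>j\<ge>m. \<forall>w. r j \<notin> hair w"
  proof (rule ccontr)
    assume "\<not> ?thesis"
    hence in_hair: "\<exists>w. r j \<in> hair w" if "m \<le> j" for j
      using that by blast
    then obtain w where w: "r m \<in> hair w"
      by blast
    have "r j \<in> hair w" if "m \<le> j" for j
      using that
    proof (induction j rule: dec_induct)
      case base
      show ?case by (rule w)
    next
      case (step j)
      have "adj (colgraph c) (r j) (r (Suc j))"
        using r by (simp add: ray_def)
      moreover have "r (Suc j) \<noteq> spine w 0"
        using in_hair[of "Suc j"] step by auto
      ultimately show ?case
        using hair_exit step.IH by blast
    qed
    thus False
      using out[of m w] by blast
  qed
  then obtain j where j: "m \<le> j" "\<forall>w. r j \<notin> hair w"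
    by blast
  have "?R (spine [] N) (r j)"
    using r j m[of j] by (intro F(2)) (auto simp: ray_def)
  moreover have "?R (spine [] N) (main_ray (nat N))"
    using N by (simp add: main_ray_def)
  moreover have "\<forall>i\<ge>j. r i \<notin> S" "\<forall>i\<ge>nat N. main_ray i \<notin> S"
    using m j N by (auto simp: main_ray_def)
  moreover have "spine [] N \<in> verts (colgraph c) - S"
    using N by simp
  ultimately show "\<exists>z\<in>verts (colgraph c) - S. \<exists>m n. (\<forall>j\<ge>m. r j \<notin> S) \<and> (\<forall>j\<ge>n. main_ray j \<notin> S) \<and>
      ?R z (r m) \<and> ?R z (main_ray n)"
    by blast
qed

lemma equivalent_hair_ray:
  assumes r: "ray (colgraph c) r" and w: "distinct_adj w" and tail: "\<And>j. m \<le> j \<Longrightarrow> r j \<in> hair w"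
  shows "equivalent_rays (colgraph c) r (hair_ray w)"
proof (rule equivalent_rays_reachI[OF r ray_hair_ray[OF w]])
  fix S :: "nat set" assume S: "finite S"
  let ?R = "(adj (delete_verts (colgraph c) S))\<^sup>*\<^sup>*"
  obtain N where N: "0 \<le> N" "\<And>w n. N \<le> \<bar>n\<bar> \<Longrightarrow> spine w n \<notin> S"
    using finite_spine_levels[OF S] by blast
  hence N': "\<And>n. n \<le> - N \<Longrightarrow> spine w n \<notin> S"
    by force
  have sp: "?R (spine w (- N)) (spine w n)" if "n \<le> - N" for n
    using that N' w by (intro rtranclp_adj_sym[OF spine_reach]) auto
  \<comment> \<open>Level \<open>- N\<close> is included, so a vertex of the hair outside
    \<open>F\<close> has level below \<open>- N\<close>, and a twig there hangs from a spine vertex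
    of level at most \<open>- N\<close>.\<close>
  define F where "F = spine w ` {- N..<0} \<union> twig w ` {- N..<0}"
  obtain k where k: "\<And>j. k \<le> j \<Longrightarrow> r j \<notin> F \<union> S"
    using ray_tail_avoids[OF r, of "F \<union> S"] S by (auto simp: F_def)
  have in_hair: "r (max m k) \<in> hair w" and notin: "r (max m k) \<notin> F" "r (max m k) \<notin> S"
    using tail k[of "max m k"] by auto
  consider n where "n < 0" "r (max m k) = spine w n" | n where "n < 0" "r (max m k) = twig w n"
    using in_hair by (auto simp: hair_def)
  hence "?R (spine w (- N)) (r (max m k))"
  proof cases
    case (1 n)
    hence "n \<le> - N"
      using notin by (force simp: F_def)
    thus ?thesis
      using 1 sp by simp
  next
    case (2 n)
    hence n: "n + 1 \<le> - N"
      using notin by (force simp: F_def)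
    have "adj (delete_verts (colgraph c) S) (spine w (n + 1)) (r (max m k))"
      using 2 N' n notin w by (simp add: adj_delete_verts)
    with sp[OF n] show ?thesis
      by (rule rtranclp.rtrancl_into_rtrancl)
  qed
  moreover have "?R (spine w (- N)) (hair_ray w (nat N))"
    using sp[of "- 1 - N"] N(1) by (simp add: hair_ray_def algebra_simps)
  moreover have "\<forall>j\<ge>max m k. r j \<notin> S" "\<forall>j\<ge>nat N. hair_ray w j \<notin> S"
    using k N' by (auto simp: hair_ray_def)
  moreover have "spine w (- N) \<in> verts (colgraph c) - S"
    using N' w by simp
  ultimately show "\<exists>z\<in>verts (colgraph c) - S. \<exists>m n. (\<forall>j\<ge>m. r j \<notin> S) \<and> (\<forall>j\<ge>n. hair_ray w j \<notin> S) \<and>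
      ?R z (r m) \<and> ?R z (hair_ray w n)"
    by blast
qed

text \<open>After deletion of \<open>spine w 0\<close>, no path leaves
  \<open>hair w\<close>.\<close>

lemma hair_rays_inequivalent:
  assumes w: "distinct_adj w" and "equivalent_rays (colgraph c) (hair_ray w) (hair_ray w')"
  shows "w = w'"
proof -
  let ?R = "(adj (delete_verts (colgraph c) {spine w 0}))\<^sup>*\<^sup>*"
  obtain C m n where C: "C \<in> components (delete_verts (colgraph c) {spine w 0})"
    "hair_ray w ` {m..} \<subseteq> C" "hair_ray w' ` {n..} \<subseteq> C"
    using equivalent_raysE[OF assms(2), of "{spine w 0}"] w by auto
  then obtain z where "C = component_of (delete_verts (colgraph c) {spine w 0}) z"
    by (auto simp: components_def)
  hence "?R z (hair_ray w m)" "?R z (hair_ray w' n)"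
    using C by (auto simp: component_of_def)
  hence "?R (hair_ray w m) (hair_ray w' n)"
    by (meson rtranclp_adj_sym rtranclp_trans)
  hence "hair_ray w' n \<in> hair w"
  proof induction
    case base
    show ?case by (simp add: hair_ray_def)
  next
    case (step u v)
    thus ?case
      using hair_exit by (auto simp: adj_delete_verts)
  qed
  thus ?thesis
    by (simp add: hair_ray_def)
qed

lemma hair_distinct_adj:
  assumes "v \<in> hair w" "v \<in> verts (colgraph c)"
  shows "distinct_adj w"
  using assms by (auto simp: hair_def)

text \<open>A ray either has a tail in one hair or is outside each hair infinitely often, so
  \<open>main_ray\<close> and the rays \<open>hair_ray w\<close> represent all ends.\<close>

lemma countable_ends_colgraph: "countable (ends (colgraph c))"
proof (rule countable_subset)
  let ?G = "colgraph c"
  let ?cl = "\<lambda>r. ray_equiv ?G `` {r}"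
  show "ends ?G \<subseteq> ?cl ` insert main_ray (range hair_ray)"
  proof
    fix X assume "X \<in> ends ?G"
    then obtain r where r: "ray ?G r" and X: "X = ?cl r"
      unfolding ends_def by (auto elim: quotientE)
    have "\<exists>s \<in> insert main_ray (range hair_ray). ray ?G s \<and> equivalent_rays ?G r s"
    proof (cases "\<exists>w m. \<forall>j\<ge>m. r j \<in> hair w")
      case True
      then obtain w m where wm: "\<And>j. m \<le> j \<Longrightarrow> r j \<in> hair w"
        by blast
      moreover have "r m \<in> verts ?G"
        using r by (auto simp: ray_def)
      ultimately have "distinct_adj w"
        using hair_distinct_adj by blast
      thus ?thesis
        using equivalent_hair_ray[OF r _ wm] ray_hair_ray by blast
    next
      case False
      thus ?thesis
        using equivalent_main_ray[OF r] ray_main_ray by blast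
    qed
    then obtain s where "s \<in> insert main_ray (range hair_ray)" "(r, s) \<in> ray_equiv ?G"
      using r by (auto simp: ray_equiv_def)
    thus "X \<in> ?cl ` insert main_ray (range hair_ray)"
      unfolding X using equiv_class_eq[OF equiv_ray_equiv] by blast
  qed
qed simp

lemma infinite_ends_colgraph: "infinite (ends (colgraph c))"
proof
  let ?G = "colgraph c"
  let ?f = "\<lambda>m. ray_equiv ?G `` {hair_ray [m]}"
  assume "finite (ends ?G)"
  moreover have "range ?f \<subseteq> ends ?G"
    unfolding ends_def by (auto intro!: quotientI ray_hair_ray)
  moreover have "inj ?f"
  proof (rule injI)
    fix m n assume "?f m = ?f n"
    hence "(hair_ray [m], hair_ray [n]) \<in> ray_equiv ?G"
      using eq_equiv_class[OF _ equiv_ray_equiv] ray_hair_ray[of "[n]" c] by auto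
    hence "equivalent_rays ?G (hair_ray [m]) (hair_ray [n])"
      by (simp add: ray_equiv_def)
    thus "m = n"
      using hair_rays_inequivalent[of "[m]" c "[n]"] by simp
  qed
  ultimately show False
    using finite_subset range_inj_infinite by blast
qed

subsection \<open>Two colourings\<close>

text \<open>The Boolean selects the side of the \<open>m\<close>-th generator on which the discrepancy is placed:
  infinitely many generators are needed for every vertex of either graph.\<close>

definition flip :: "nat \<Rightarrow> nat list \<times> int" where
  "flip m = (case from_nat (fst (prod_decode m)) of (w, n, b) \<Rightarrow>
     let w' = if distinct_adj w then w else [] in (if b then lmul m w' else w', n))"

lemma flip_reduced: "distinct_adj (fst (flip m))"
  by (simp add: flip_def Let_def split: prod.split)

text \<open>The place is coded in the first component of the pair decoded from \<open>m\<close>; the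
  second component is free and repeats each place infinitely often.\<close>

lemma infinite_flip:
  assumes w: "distinct_adj w"
  shows "infinite {m. flip m = (w, n)}" "infinite {m. flip m = (lmul m w, n)}"
proof -
  have inf: "infinite (range (\<lambda>k. prod_encode (i, k)))" for i
    by (intro range_inj_infinite injI) (simp add: inj_eq[OF inj_prod_encode])
  have "range (\<lambda>k. prod_encode (to_nat (w, n, False), k)) \<subseteq> {m. flip m = (w, n)}"
    using w by (auto simp: flip_def)
  thus "infinite {m. flip m = (w, n)}"
    using inf finite_subset by blast
  have "range (\<lambda>k. prod_encode (to_nat (w, n, True), k)) \<subseteq> {m. flip m = (lmul m w, n)}"
    using w by (auto simp: flip_def)
  thus "infinite {m. flip m = (lmul m w, n)}"
    using inf finite_subset by blast
qed

text \<open>This solves the demand of \<open>col_lmul\<close> along the Cayley tree: the values at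
  the empty word are free, and stripping first letters forces all others. Both colourings are
  defined together since each letter swaps them; the place \<open>flip m\<close> refers to the
  argument of \<open>col False\<close>.\<close>

fun col :: "bool \<Rightarrow> nat list \<Rightarrow> int \<Rightarrow> bool" where
  "col b [] n = b"
| "col b (m # w) n = (col (\<not> b) w n \<noteq> (flip m = (if b then w else m # w, n)))"

text \<open>One of \<open>w\<close> and \<open>lmul m w\<close> is the other with \<open>m\<close>
  put in front, so a single unfolding of \<open>col\<close> compares them.\<close>

lemma col_lmul: "col b w n \<noteq> col (\<not> b) (lmul m w) n \<longleftrightarrow> flip m = (if b then lmul m w else w, n)"
  by (cases w) auto

section \<open>Left translation by a word \<open>h\<close>, written
  \<open>foldr lmul h\<close>\<close>

lemma foldr_lmul_reduced [simp]: "distinct_adj w \<Longrightarrow> distinct_adj (foldr lmul h w)"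
  by (induction h) auto

lemma foldr_lmul_Nil: "distinct_adj h \<Longrightarrow> foldr lmul h [] = h"
proof (induction h)
  case (Cons a h)
  hence "foldr lmul h [] = h"
    by (cases h) auto
  thus ?case
    using Cons.prems by (cases h) auto
qed simp

lemma foldr_lmul_rmul: "foldr lmul h (rmul l w) = rmul l (foldr lmul h w)"
  by (induction h) (auto simp: lmul_rmul)

lemma foldr_lmul_rev [simp]:
  "distinct_adj w \<Longrightarrow> foldr lmul (rev h) (foldr lmul h w) = w"
  by (induction h arbitrary: w) auto

lemma foldr_lmul_rev' [simp]:
  "distinct_adj w \<Longrightarrow> foldr lmul h (foldr lmul (rev h) w) = w"
  using foldr_lmul_rev[of w "rev h"] by simp

text \<open>Each further letter swaps the two colourings and, by \<open>col_lmul\<close>, toggles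
  membership of exactly one place in the difference set, so the parity of its size changes.\<close>

lemma col_translate_parity:
  fixes b h
  defines "A \<equiv> {(w, n). distinct_adj w \<and> col b w n \<noteq> col (b \<noteq> odd (length h)) (foldr lmul h w) n}"
  shows "finite A \<and> (odd (card A) \<longleftrightarrow> odd (length h))"
  unfolding A_def
proof (induction h)
  case Nil
  show ?case by simp
next
  case (Cons m h)
  let ?b = "b \<noteq> odd (length h)"
  let ?A = "{(w, n). distinct_adj w \<and> col b w n \<noteq> col ?b (foldr lmul h w) n}"
  let ?A' = "{(w, n). distinct_adj w \<and> col b w n \<noteq> col (\<not> ?b) (foldr lmul (m # h) w) n}"
  obtain z k where zk: "flip m = (z, k)"
    by (cases "flip m")
  have z: "distinct_adj z"
    using flip_reduced[of m] zk by simp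
  \<comment> \<open>The place prescribed for \<open>m\<close>, pulled back through the translation
    by \<open>h\<close>; if \<open>?b\<close> holds it lies on the far side of \<open>m\<close>,
    which is undone first.\<close>
  define x where "x = foldr lmul (rev h) (if ?b then lmul m z else z)"
  have x: "distinct_adj x"
    using z by (simp add: x_def)
  have "z = (if ?b then lmul m (foldr lmul h w) else foldr lmul h w) \<longleftrightarrow> w = x"
    if w: "distinct_adj w" for w
  proof
    assume "z = (if ?b then lmul m (foldr lmul h w) else foldr lmul h w)"
    thus "w = x"
      using w by (cases ?b) (simp_all add: x_def)
  next
    assume "w = x"
    thus "z = (if ?b then lmul m (foldr lmul h w) else foldr lmul h w)"
      using z by (cases ?b) (simp_all add: x_def)
  qed
  hence step: "col ?b (foldr lmul h w) n \<noteq> col (\<not> ?b) (foldr lmul (m # h) w) n \<longleftrightarrow> (w, n) = (x, k)"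
    if "distinct_adj w" for w n
    using that col_lmul[of ?b "foldr lmul h w" n m] zk by auto
  define A A' where "A = ?A" and "A' = ?A'"
  have "(w, n) \<in> A' \<longleftrightarrow> ((w, n) \<in> A) \<noteq> ((w, n) = (x, k))" for w n
    using step[of w n] x unfolding A_def A'_def by (cases "distinct_adj w") blast+
  hence "A' = (if (x, k) \<in> A then A - {(x, k)} else insert (x, k) A)"
    by auto
  moreover have A: "finite A" "odd (card A) \<longleftrightarrow> odd (length h)"
    using Cons.IH by (simp_all only: A_def)
  moreover have "odd (card (A - {(x, k)})) \<longleftrightarrow> \<not> odd (card A)" if "(x, k) \<in> A"
    using card_Suc_Diff1[OF A(1) that] by (metis even_Suc)
  ultimately have "finite A' \<and> (odd (card A') \<longleftrightarrow> \<not> odd (length h))"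
    by simp
  moreover have "(b \<noteq> odd (length (m # h))) = (\<not> ?b)"
    by simp
  ultimately show ?case
    by (simp only: A'_def) simp
qed

subsection \<open>Rigidity\<close>

text \<open>Spine vertices are those of degree at least three; those with three spine neighbours have
  nonnegative level, and the level is then determined by the distance to the spine vertices of the
  opposite sign. No step depends on the colouring.\<close>

lemma colgraph_iso_rigid:
  assumes bij: "bij_betw f (verts (colgraph c)) (verts (colgraph c'))"
    and adj: "\<And>u v. u \<in> verts (colgraph c) \<Longrightarrow> v \<in> verts (colgraph c) \<Longrightarrow>
      adj (colgraph c) u v \<longleftrightarrow> adj (colgraph c') (f u) (f v)"
  obtains \<sigma> where "\<And>w. distinct_adj w \<Longrightarrow> distinct_adj (\<sigma> w)"
    "\<And>l w. distinct_adj w \<Longrightarrow> \<sigma> (rmul l w) = rmul l (\<sigma> w)"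
    "\<And>w n. distinct_adj w \<Longrightarrow> c w n = c' (\<sigma> w) n"
proof -
  let ?G = "colgraph c" and ?G' = "colgraph c'"
  \<comment> \<open>These predicates read the code of a vertex, so they make sense in both graphs at
    once. Each is then characterised by adjacency, which makes it invariant under \<open>f\<close>.
    Rank counts from the step between levels -1 and 0.\<close>
  define sp where "sp v \<longleftrightarrow> (\<exists>w n. v = spine w n)" for v
  define main where "main v \<longleftrightarrow> (\<exists>w n. v = spine w n \<and> 0 \<le> n)" for v
  define rank where "rank k v \<longleftrightarrow> (\<exists>w n. v = spine w n \<and> (n = int k \<or> n = - 1 - int k))" for k v
  have f_verts: "f v \<in> verts ?G'" if "v \<in> verts ?G" for v
    using bij that by (rule bij_betw_apply)
  \<comment> \<open>The engine of the invariance: if a property is carried along by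
    \<open>f\<close>, so are the number and the existence of neighbours having it.\<close>
  have nbrs: "bij_betw f {u. adj ?G v u \<and> P u} {u. adj ?G' (f v) u \<and> P' u}"
    if v: "v \<in> verts ?G" and P: "\<And>u. u \<in> verts ?G \<Longrightarrow> P u \<longleftrightarrow> P' (f u)" for v P P'
    unfolding bij_betw_def
  proof
    show "inj_on f {u. adj ?G v u \<and> P u}"
      using bij adj_colgraph_verts by (auto simp: bij_betw_def inj_on_def)
    show "f ` {u. adj ?G v u \<and> P u} = {u. adj ?G' (f v) u \<and> P' u}"
    proof (intro equalityI subsetI)
      fix u assume "u \<in> f ` {u. adj ?G v u \<and> P u}"
      thus "u \<in> {u. adj ?G' (f v) u \<and> P' u}"
        using adj P v adj_colgraph_verts by blast
    next
      fix u assume u: "u \<in> {u. adj ?G' (f v) u \<and> P' u}"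
      hence "u \<in> verts ?G'"
        using adj_colgraph_verts by blast
      then obtain x where "x \<in> verts ?G" "u = f x"
        using bij by (auto simp: bij_betw_def)
      thus "u \<in> f ` {u. adj ?G v u \<and> P u}"
        using u adj P v by blast
    qed
  qed
  have nbr_card: "card {u. adj ?G v u \<and> P u} = card {u. adj ?G' (f v) u \<and> P' u}"
    if "v \<in> verts ?G" "\<And>u. u \<in> verts ?G \<Longrightarrow> P u \<longleftrightarrow> P' (f u)" for v P P'
    by (intro bij_betw_same_card[of f] nbrs that)
  have nbr_ex: "(\<exists>u. adj ?G v u \<and> P u) \<longleftrightarrow> (\<exists>u. adj ?G' (f v) u \<and> P' u)"
    if "v \<in> verts ?G" "\<And>u. u \<in> verts ?G \<Longrightarrow> P u \<longleftrightarrow> P' (f u)" for v P P'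
  proof -
    have "bij_betw f {u. adj ?G v u \<and> P u} {u. adj ?G' (f v) u \<and> P' u}"
      by (intro nbrs that)
    thus ?thesis
      unfolding bij_betw_def by blast
  qed

  have fin: "finite {u. adj (colgraph d) v u}" if "v \<in> verts (colgraph d)" for d v
    using bounded_degree_colgraph[of d] that unfolding bounded_degree_def by blast
  have sp_char: "sp v \<longleftrightarrow> 3 \<le> card {u. adj (colgraph d) v u}" if v: "v \<in> verts (colgraph d)" for d v
    using v
  proof (cases rule: verts_colgraphE)
    case (1 w n)
    \<comment> \<open>The twig of level \<open>n - 1\<close> is chosen because its edge to this
      spine vertex is present in every colouring.\<close>
    have "card {spine w (n + 1), spine w (n - 1), twig w (n - 1)} \<le> card {u. adj (colgraph d) v u}"
      using 1 by (intro card_mono fin v) auto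
    thus ?thesis
      using 1 by (simp add: sp_def)
  next
    case (2 w n)
    have "{u. adj (colgraph d) v u} \<subseteq> {spine w n, spine w (n + 1)}"
    proof
      fix u assume "u \<in> {u. adj (colgraph d) v u}"
      hence a: "adj (colgraph d) v u" by simp
      hence "u \<in> verts (colgraph d)"
        using adj_colgraph_verts by blast
      thus "u \<in> {spine w n, spine w (n + 1)}"
        by (rule verts_colgraphE) (use 2 a in auto)
    qed
    hence "card {u. adj (colgraph d) v u} \<le> card {spine w n, spine w (n + 1)}"
      by (intro card_mono) auto
    thus ?thesis
      using 2 by (auto simp: sp_def)
  qed
  have sp_f: "sp v \<longleftrightarrow> sp (f v)" if "v \<in> verts ?G" for v
    using nbr_card[of v "\<lambda>_. True" "\<lambda>_. True"] sp_char[of v c] sp_char[of "f v" c'] that f_verts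
    by simp

  have main_char: "main v \<longleftrightarrow> sp v \<and> 3 \<le> card {u. adj (colgraph d) v u \<and> sp u}"
    if v: "v \<in> verts (colgraph d)" for d v
    using v
  proof (cases rule: verts_colgraphE)
    case (1 w n)
    show ?thesis
    proof (cases "0 \<le> n")
      case True
      have "card {spine w (n + 1), spine w (n - 1), spine (rmul (gate n) w) n}
          \<le> card {u. adj (colgraph d) v u \<and> sp u}"
        using 1 True fin[OF v] by (intro card_mono) (auto simp: sp_def)
      thus ?thesis
        using 1 True by (simp add: sp_def main_def)
    next
      case False
      have "{u. adj (colgraph d) v u \<and> sp u} \<subseteq> {spine w (n + 1), spine w (n - 1)}"
        using 1 False by (auto simp: sp_def)
      hence "card {u. adj (colgraph d) v u \<and> sp u} \<le> card {spine w (n + 1), spine w (n - 1)}"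
        by (intro card_mono) auto
      thus ?thesis
        using 1 False by (auto simp: sp_def main_def)
    qed
  next
    case (2 w n)
    thus ?thesis
      by (auto simp: sp_def main_def)
  qed
  have main_f: "main v \<longleftrightarrow> main (f v)" if "v \<in> verts ?G" for v
    using nbr_card[of v sp sp] main_char[of v c] main_char[of "f v" c'] that f_verts sp_f by simp

  have rank_0_char: "rank 0 v \<longleftrightarrow> sp v \<and> (\<exists>u. adj (colgraph d) v u \<and> sp u \<and> main u \<noteq> main v)"
    if v: "v \<in> verts (colgraph d)" for d v
    using v
  proof (cases rule: verts_colgraphE)
    case (1 w n)
    have "\<exists>u. adj (colgraph d) v u \<and> sp u \<and> main u \<noteq> main v" if "n = 0 \<or> n = - 1"
      using 1 that
      \<comment> \<open>The reflection to \<open>- 1 - n\<close> exchanges levels 0 and -1.\<close>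
      by (intro exI[of _ "spine w (- 1 - n)"]) (auto simp: sp_def main_def)
    moreover have "n = 0 \<or> n = - 1" if "\<exists>u. adj (colgraph d) v u \<and> sp u \<and> main u \<noteq> main v"
      using 1 that by (auto simp: sp_def main_def)
    ultimately show ?thesis
      using 1 by (auto simp: sp_def rank_def)
  next
    case (2 w n)
    thus ?thesis
      by (auto simp: sp_def rank_def)
  qed
  have rank_Suc_char: "rank (Suc k) v \<longleftrightarrow> sp v \<and> \<not> (\<exists>j\<le>k. rank j v) \<and>
      (\<exists>u. adj (colgraph d) v u \<and> rank k u \<and> main u = main v)"
    if v: "v \<in> verts (colgraph d)" for d v k
    using v
  proof (cases rule: verts_colgraphE)
    case (1 w n)
    have rank_v: "rank j v \<longleftrightarrow> n = int j \<or> n = - 1 - int j" for j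
      using 1 by (auto simp: rank_def)
    have "\<exists>u. adj (colgraph d) v u \<and> rank k u \<and> main u = main v" if "rank (Suc k) v"
    proof (cases "0 \<le> n")
      case True
      thus ?thesis
        using 1 that rank_v[of "Suc k"]
        by (intro exI[of _ "spine w (int k)"]) (auto simp: rank_def main_def)
    next
      case False
      thus ?thesis
        using 1 that rank_v[of "Suc k"]
        by (intro exI[of _ "spine w (- 1 - int k)"]) (auto simp: rank_def main_def)
    qed
    moreover have "rank (Suc k) v"
      if not: "\<not> (\<exists>j\<le>k. rank j v)" and ex: "\<exists>u. adj (colgraph d) v u \<and> rank k u \<and> main u = main v"
    proof -
      obtain w' n' where u: "adj (colgraph d) v (spine w' n')" "n' = int k \<or> n' = - 1 - int k"
        "0 \<le> n' \<longleftrightarrow> 0 \<le> n"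
        using ex 1 by (auto simp: rank_def main_def)
      have "\<not> (n = int j \<or> n = - 1 - int j)" if "j \<le> k" for j
        using not rank_v that by blast
      \<comment> \<open>Adjacent levels differ by at most one and the sign is kept, so excluding
        ranks \<open>k\<close> and \<open>k - 1\<close> leaves only \<open>k + 1\<close>.\<close>
      from this[of k] this[of "k - 1"] show ?thesis
        using u 1 unfolding rank_v by auto
    qed
    moreover have "\<not> (\<exists>j\<le>k. rank j v)" if "rank (Suc k) v"
      using that unfolding rank_v by auto
    moreover have "sp v"
      using 1 by (auto simp: sp_def)
    ultimately show ?thesis
      by blast
  next
    case (2 w n)
    thus ?thesis
      by (auto simp: sp_def rank_def)
  qed
  have rank_f: "rank k v \<longleftrightarrow> rank k (f v)" if "v \<in> verts ?G" for k v
    using that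
  proof (induction k arbitrary: v rule: less_induct)
    case (less k)
    show ?case
    proof (cases k)
      case 0
      show ?thesis
        unfolding 0 rank_0_char[OF less.prems] rank_0_char[OF f_verts[OF less.prems]]
        using nbr_ex[of v "\<lambda>u. sp u \<and> main u \<noteq> main v" "\<lambda>u. sp u \<and> main u \<noteq> main (f v)"]
          sp_f main_f less.prems by simp
    next
      case (Suc i)
      have "(\<exists>j\<le>i. rank j v) \<longleftrightarrow> (\<exists>j\<le>i. rank j (f v))"
        using less Suc by (metis le_imp_less_Suc)
      moreover have "(\<exists>u. adj ?G v u \<and> rank i u \<and> main u = main v) \<longleftrightarrow>
          (\<exists>u. adj ?G' (f v) u \<and> rank i u \<and> main u = main (f v))"
        using less Suc main_f by (intro nbr_ex) auto
      ultimately show ?thesis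
        unfolding Suc rank_Suc_char[OF less.prems] rank_Suc_char[OF f_verts[OF less.prems]]
        using sp_f[OF less.prems] by simp
    qed
  qed

  have level: "\<exists>w'. distinct_adj w' \<and> f (spine w n) = spine w' n" if w: "distinct_adj w" for w n
  proof -
    let ?v = "spine w n" and ?k = "nat (if 0 \<le> n then n else - 1 - n)"
    have v: "?v \<in> verts ?G"
      using w by simp
    have "rank ?k ?v"
      by (auto simp: rank_def)
    hence "rank ?k (f ?v)"
      using rank_f[OF v] by simp
    then obtain w' n' where w': "f ?v = spine w' n'" "n' = int ?k \<or> n' = - 1 - int ?k"
      by (auto simp: rank_def)
    have "0 \<le> n \<longleftrightarrow> 0 \<le> n'"
      using main_f[OF v] w' by (auto simp: main_def)
    with w'(2) have "n' = n"
      by (cases "0 \<le> n") auto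
    thus ?thesis
      using w' f_verts[OF v] by auto
  qed
  define \<sigma> where "\<sigma> w = (SOME w'. distinct_adj w' \<and> f (spine w 0) = spine w' 0)" for w
  have \<sigma>: "distinct_adj (\<sigma> w)" "f (spine w 0) = spine (\<sigma> w) 0" if "distinct_adj w" for w
    using someI_ex[OF level[OF that, of 0]] by (simp_all add: \<sigma>_def)
  \<comment> \<open>Edges between different levels stay on one spine, so the word read off at level
    0 is the same at all levels.\<close>
  have f_spine: "f (spine w n) = spine (\<sigma> w) n" if w: "distinct_adj w" for w n
  proof (induction n rule: int_induct[of _ 0])
    case base
    show ?case by (rule \<sigma>(2)[OF w])
  next
    case (step1 i)
    obtain y where y: "f (spine w (i + 1)) = spine y (i + 1)"
      using level[OF w] by blast
    have "adj ?G' (f (spine w i)) (f (spine w (i + 1)))"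
      using w by (subst adj[symmetric]) auto
    thus ?case
      using y step1 by auto
  next
    case (step2 i)
    obtain y where y: "f (spine w (i - 1)) = spine y (i - 1)"
      using level[OF w] by blast
    have "adj ?G' (f (spine w i)) (f (spine w (i - 1)))"
      using w by (subst adj[symmetric]) auto
    thus ?case
      using y step2 by auto
  qed
  have f_twig: "f (twig w n) = twig (\<sigma> w) n" if w: "distinct_adj w" for w n
  proof -
    have v: "twig w n \<in> verts ?G"
      using w by simp
    have "\<not> sp (f (twig w n))"
      using sp_f[OF v] by (simp add: sp_def)
    then obtain y m where y: "f (twig w n) = twig y m"
      using f_verts[OF v] by (auto simp: sp_def elim: verts_colgraphE)
    have "adj ?G' (f (spine w (n + 1))) (f (twig w n))"
      using w by (subst adj[symmetric]) auto
    hence ym: "y = \<sigma> w" "m = n \<or> m = n + 1"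
      using y f_spine[OF w] by auto
    \<comment> \<open>A colour edge could have simulated the attachment at \<open>n + 1\<close>; but
      a twig of level \<open>n + 1\<close> would also be attached at \<open>n + 2\<close>, where
      \<open>twig w n\<close> has no neighbour.\<close>
    have "\<not> adj ?G' (f (spine w (n + 2))) (f (twig w n))"
      using w by (subst adj[symmetric]) auto
    hence "m \<noteq> n + 1"
      using y ym f_spine[OF w] \<sigma>(1)[OF w] by auto
    thus ?thesis
      using y ym by simp
  qed
  show ?thesis
  proof
    show "distinct_adj (\<sigma> w)" if "distinct_adj w" for w
      using \<sigma>(1) that .
    show "\<sigma> (rmul l w) = rmul l (\<sigma> w)" if w: "distinct_adj w" for l w
    proof -
      obtain n where n: "0 \<le> n" "gate n = l"
        using gate_cofinal by blast
      have "adj ?G' (f (spine w n)) (f (spine (rmul l w) n))"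
        using w n by (subst adj[symmetric]) auto
      thus ?thesis
        using w n by (auto simp: f_spine)
    qed
    show "c w n = c' (\<sigma> w) n" if w: "distinct_adj w" for w n
    proof -
      have "adj ?G (spine w n) (twig w n) \<longleftrightarrow> adj ?G' (f (spine w n)) (f (twig w n))"
        using w by (intro adj) auto
      thus ?thesis
        using w \<sigma>(1) by (simp add: f_spine f_twig)
    qed
  qed
qed

section \<open>Non-isomorphism of the two graphs\<close>

lemma not_graph_iso_col: "\<not> graph_iso (colgraph (col False)) (colgraph (col True))"
proof
  assume "graph_iso (colgraph (col False)) (colgraph (col True))"
  then obtain f where
    bij: "bij_betw f (verts (colgraph (col False))) (verts (colgraph (col True)))" and
    adj: "\<And>u v. u \<in> verts (colgraph (col False)) \<Longrightarrow> v \<in> verts (colgraph (col False)) \<Longrightarrow>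
      adj (colgraph (col False)) u v \<longleftrightarrow> adj (colgraph (col True)) (f u) (f v)"
    unfolding graph_iso_def by blast
  obtain \<sigma> where \<sigma>: "\<And>w. distinct_adj w \<Longrightarrow> distinct_adj (\<sigma> w)"
    "\<And>l w. distinct_adj w \<Longrightarrow> \<sigma> (rmul l w) = rmul l (\<sigma> w)"
    "\<And>w n. distinct_adj w \<Longrightarrow> col False w n = col True (\<sigma> w) n"
    using colgraph_iso_rigid[OF bij adj] by metis
  define h where "h = \<sigma> []"
  have h: "distinct_adj h"
    using \<sigma>(1) by (simp add: h_def)
  \<comment> \<open>A map commuting with all right multiplications is left multiplication by the
    image of the identity.\<close>
  have act: "\<sigma> w = foldr lmul h w" if "distinct_adj w" for w
    using that
  proof (induction w rule: rev_induct)
    case Nil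
    show ?case
      using foldr_lmul_Nil[OF h] by (simp add: h_def)
  next
    case (snoc l w)
    have w: "distinct_adj w"
      using snoc.prems by (simp add: distinct_adj_append_iff)
    have "\<sigma> (rmul l w) = foldr lmul h (rmul l w)"
      using snoc.IH w \<sigma>(2) by (simp add: foldr_lmul_rmul)
    thus ?case
      using rmul_append_letter[OF snoc.prems] by simp
  qed
  show False
  proof (cases "odd (length h)")
    case True
    hence empty: "{(w, n). distinct_adj w \<and> col False w n \<noteq> col (False \<noteq> odd (length h)) (foldr lmul h w) n} = {}"
      using \<sigma>(3) act by auto
    thus False
      using col_translate_parity[of False h] True unfolding empty by simp
  next
    case False
    let ?A = "{(w, n). distinct_adj w \<and> col True w n \<noteq> col (True \<noteq> odd (length h)) (foldr lmul h w) n}"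
    \<comment> \<open>At the empty word \<open>col True\<close> is \<open>True\<close>, whereas its
      translate takes the value of \<open>col False\<close> there, which is \<open>False\<close>, at
      every level.\<close>
    have "range (\<lambda>n :: int. ([] :: nat list, n)) \<subseteq> ?A"
      using \<sigma>(3)[of "[]"] act[of "[]"] False by auto
    moreover have "infinite (range (\<lambda>n :: int. ([] :: nat list, n)))"
      by (simp add: finite_image_iff inj_on_def infinite_UNIV_int)
    ultimately show False
      using col_translate_parity[of True h] finite_subset by blast
  qed
qed

subsection \<open>Hypomorphism\<close>

lemma graph_iso_sym: "graph_iso G H \<Longrightarrow> graph_iso H G"
  unfolding graph_iso_def
proof (elim exE conjE)
  fix f assume f: "bij_betw f (verts G) (verts H)"
    "\<forall>u\<in>verts G. \<forall>v\<in>verts G. adj G u v \<longleftrightarrow> adj H (f u) (f v)"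
  let ?g = "the_inv_into (verts G) f"
  have "\<forall>u\<in>verts H. ?g u \<in> verts G \<and> f (?g u) = u"
    using f(1) by (auto simp: bij_betw_def the_inv_into_into f_the_inv_into_f)
  hence "\<forall>u\<in>verts H. \<forall>v\<in>verts H. adj H u v \<longleftrightarrow> adj G (?g u) (?g v)"
    using f(2) by metis
  thus "\<exists>g. bij_betw g (verts H) (verts G) \<and>
      (\<forall>u\<in>verts H. \<forall>v\<in>verts H. adj H u v \<longleftrightarrow> adj G (g u) (g v))"
    using bij_betw_the_inv_into[OF f(1)] by blast
qed

lemma graph_iso_trans: "graph_iso G H \<Longrightarrow> graph_iso H K \<Longrightarrow> graph_iso G K"
  unfolding graph_iso_def
proof (elim exE conjE)
  fix f g assume f: "bij_betw f (verts G) (verts H)"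
    "\<forall>u\<in>verts G. \<forall>v\<in>verts G. adj G u v \<longleftrightarrow> adj H (f u) (f v)"
    and g: "bij_betw g (verts H) (verts K)"
    "\<forall>u\<in>verts H. \<forall>v\<in>verts H. adj H u v \<longleftrightarrow> adj K (g u) (g v)"
  have "\<forall>u\<in>verts G. \<forall>v\<in>verts G. adj G u v \<longleftrightarrow> adj K ((g \<circ> f) u) ((g \<circ> f) v)"
    using f(2) g(2) bij_betw_apply[OF f(1)] by simp
  thus "\<exists>h. bij_betw h (verts G) (verts K) \<and>
      (\<forall>u\<in>verts G. \<forall>v\<in>verts G. adj G u v \<longleftrightarrow> adj K (h u) (h v))"
    using bij_betw_trans[OF f(1) g(1)] by blast
qed

text \<open>The relation is a disjoint union of products of countably infinite sets.\<close>

lemma bij_betw_of_difunctional: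
  fixes R :: "'a \<Rightarrow> 'b \<Rightarrow> bool"
  assumes "countable V" "countable W"
    and R_dif: "\<And>v w v' w'. R v w \<Longrightarrow> R v' w \<Longrightarrow> R v' w' \<Longrightarrow> R v w'"
    and infW: "\<And>v. v \<in> V \<Longrightarrow> infinite {w \<in> W. R v w}"
    and infV: "\<And>w. w \<in> W \<Longrightarrow> infinite {v \<in> V. R v w}"
  shows "\<exists>\<phi>. bij_betw \<phi> V W \<and> (\<forall>v\<in>V. R v (\<phi> v))"
proof -
  \<comment> \<open>\<open>C v\<close> and \<open>K v\<close> are the two factors of the product
    block containing \<open>v\<close>.\<close>
  define C where "C v = {w \<in> W. R v w}" for v
  define K where "K v = {v' \<in> V. C v' = C v}" for v
  have C_eq: "C v = C v'" if "w \<in> C v" "w \<in> C v'" for v v' w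
    using that R_dif unfolding C_def by blast
  have C: "countable (C v)" "infinite (C v)" if "v \<in> V" for v
    using infW[OF that] \<open>countable W\<close> by (auto simp: C_def intro: countable_subset)
  have K: "countable (K v)" "infinite (K v)" if v: "v \<in> V" for v
  proof -
    show "countable (K v)"
      using \<open>countable V\<close> by (auto simp: K_def intro: countable_subset)
    obtain w where w: "w \<in> C v"
      using C(2)[OF v] by fastforce
    have "{v' \<in> V. R v' w} \<subseteq> K v"
    proof
      fix v' assume v': "v' \<in> {v' \<in> V. R v' w}"
      hence "w \<in> C v'"
        using w by (simp add: C_def)
      thus "v' \<in> K v"
        using C_eq[OF _ w] v' by (simp add: K_def)
    qed
    thus "infinite (K v)"
      using infV[of w] w finite_subset by (auto simp: C_def)
  qed
  \<comment> \<open>Within a block, both factors are enumerated by the naturals, and elements with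
    equal index are matched.\<close>
  define \<phi> where "\<phi> v = from_nat_into (C v) (to_nat_on (K v) v)" for v
  have \<phi>: "\<phi> v \<in> C v" if "v \<in> V" for v
    using C(2)[OF that] unfolding \<phi>_def by (intro from_nat_into) auto
  have "inj_on \<phi> V"
  proof (rule inj_onI)
    fix v v' assume v: "v \<in> V" "v' \<in> V" "\<phi> v = \<phi> v'"
    hence CC: "C v = C v'"
      using C_eq[of "\<phi> v"] \<phi> by metis
    hence KK: "K v = K v'"
      by (simp add: K_def)
    have "to_nat_on (K v) v = to_nat_on (K v) v'"
      using v(3) C[OF v(1)] unfolding \<phi>_def CC[symmetric] KK[symmetric]
      by (metis to_nat_on_from_nat_into_infinite)
    moreover have "v \<in> K v" "v' \<in> K v"
      using v CC by (auto simp: K_def)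
    ultimately show "v = v'"
      using K(1)[OF v(1)] by (metis from_nat_into_to_nat_on)
  qed
  moreover have "\<phi> ` V = W"
  proof (intro equalityI subsetI)
    fix w assume "w \<in> \<phi> ` V"
    thus "w \<in> W"
      using \<phi> by (auto simp: C_def)
  next
    fix w assume w: "w \<in> W"
    then obtain v where v: "v \<in> V" "R v w"
      using infV[of w] by (metis (mono_tags, lifting) Collect_empty_eq finite.emptyI)
    define v' where "v' = from_nat_into (K v) (to_nat_on (C v) w)"
    have "v' \<in> K v"
      using K(2)[OF v(1)] unfolding v'_def by (intro from_nat_into) auto
    hence v': "v' \<in> V" "C v' = C v" "K v' = K v"
      by (auto simp: K_def)
    have "to_nat_on (K v) v' = to_nat_on (C v) w"
      unfolding v'_def by (rule to_nat_on_from_nat_into_infinite[OF K[OF v(1)]])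
    hence "\<phi> v' = w"
      using v' v w C(1)[OF v(1)] by (simp add: \<phi>_def C_def)
    thus "w \<in> \<phi> ` V"
      using v' by blast
  qed
  ultimately have "bij_betw \<phi> V W"
    by (simp add: bij_betw_def)
  thus ?thesis
    using \<phi> by (auto simp: C_def)
qed

text \<open>Symmetry and transitivity of isomorphism make the relation between deleted vertices
  difunctional, so infinitely many partners for every vertex on either side already yield the
  bijection.\<close>

lemma hypomorphicI:
  assumes "countable (verts G)" "countable (verts H)"
    and "\<And>v. v \<in> verts G \<Longrightarrow> infinite {w \<in> verts H. graph_iso (delete_verts G {v}) (delete_verts H {w})}"
    and "\<And>w. w \<in> verts H \<Longrightarrow> infinite {v \<in> verts G. graph_iso (delete_verts G {v}) (delete_verts H {w})}"
  shows "hypomorphic G H"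
proof -
  let ?R = "\<lambda>v w. graph_iso (delete_verts G {v}) (delete_verts H {w})"
  have "\<exists>\<phi>. bij_betw \<phi> (verts G) (verts H) \<and> (\<forall>v\<in>verts G. ?R v (\<phi> v))"
  proof (rule bij_betw_of_difunctional[OF assms(1,2)])
    show "?R v w'" if "?R v w" "?R v' w" "?R v' w'" for v w v' w'
      by (rule graph_iso_trans[OF that(1) graph_iso_trans[OF graph_iso_sym[OF that(2)] that(3)]])
  qed (fact assms(3,4))+
  thus ?thesis
    unfolding hypomorphic_def by blast
qed

text \<open>Left translation preserves all edges that do not depend on the colouring, and the one
  place where the colours may disagree belongs to an edge at the deleted vertex. Letting
  \<open>x\<close> be \<open>spine\<close> or \<open>twig\<close> treats both ends of that
  edge.\<close>

lemma graph_iso_delete_lmul: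
  assumes c: "\<And>w' n'. distinct_adj w' \<Longrightarrow> (w', n') \<noteq> (w, n) \<Longrightarrow> c w' n' = c' (lmul m w') n'"
    and x: "x = spine \<or> x = twig" and w: "distinct_adj w"
  shows "graph_iso (delete_verts (colgraph c) {x w n}) (delete_verts (colgraph c') {x (lmul m w) n})"
proof -
  define f where "f v = (case from_nat v of (w, n, b) \<Rightarrow> to_nat (lmul m w, n :: int, b :: bool))" for v :: nat
  have f: "f (spine w n) = spine (lmul m w) n" "f (twig w n) = twig (lmul m w) n" for w n
    by (simp_all add: f_def spine_def twig_def)
  have f_verts: "f v \<in> verts (colgraph d')" "f (f v) = v" if "v \<in> verts (colgraph d)" for d d' v
    using that by (auto elim!: verts_colgraphE simp: f)
  have fx: "f (x w n) = x (lmul m w) n" "f (x (lmul m w) n) = x w n"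
    using x w f by auto
  have xv: "x w n \<in> verts (colgraph c)" "x (lmul m w) n \<in> verts (colgraph c')"
    using x w by auto
  have "bij_betw f (verts (colgraph c) - {x w n}) (verts (colgraph c') - {x (lmul m w) n})"
  \<comment> \<open>Left multiplication by a generator is an involution, so \<open>f\<close> is its
    own inverse.\<close>
  proof (rule bij_betw_byWitness[where f' = f])
    show "\<forall>v\<in>verts (colgraph c) - {x w n}. f (f v) = v"
      "\<forall>v\<in>verts (colgraph c') - {x (lmul m w) n}. f (f v) = v"
      using f_verts by blast+
    show "f ` (verts (colgraph c) - {x w n}) \<subseteq> verts (colgraph c') - {x (lmul m w) n}"
      "f ` (verts (colgraph c') - {x (lmul m w) n}) \<subseteq> verts (colgraph c) - {x w n}"
      using f_verts fx by (auto, metis+)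
  qed
  moreover have "adj (colgraph c) u v \<longleftrightarrow> adj (colgraph c') (f u) (f v)"
    if u: "u \<in> verts (colgraph c)" "u \<noteq> x w n" and v: "v \<in> verts (colgraph c)" "v \<noteq> x w n" for u v
  proof -
    have inj: "lmul m w1 = lmul m w2 \<longleftrightarrow> w1 = w2" if "distinct_adj w1" "distinct_adj w2" for w1 w2
      using that by (metis lmul_lmul)
    have cc: "c w' n' = c' (lmul m w') n'"
      if "distinct_adj w'" "spine w' n' \<noteq> x w n" "twig w' n' \<noteq> x w n" for w' n'
      using that x by (intro c) auto
    show ?thesis
      using u(1)
    proof (cases rule: verts_colgraphE)
      case u': (1 w1 n1)
      show ?thesis
        using v(1)
      proof (cases rule: verts_colgraphE)
        case (1 w2 n2)
        have "w2 = rmul l w1 \<longleftrightarrow> lmul m w2 = rmul l (lmul m w1)" for l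
          using inj[of w2 "rmul l w1"] 1 u' by (simp add: lmul_rmul)
        thus ?thesis
          using 1 u' inj by (simp add: f)
      next
        case (2 w2 n2)
        thus ?thesis
          using u' u(2) v(2) inj[of w2 w1] cc[of w2 n2] by (auto simp: f)
      qed
    next
      case u': (2 w1 n1)
      show ?thesis
        using v(1)
      proof (cases rule: verts_colgraphE)
        case (1 w2 n2)
        thus ?thesis
          using u' u(2) v(2) inj[of w1 w2] cc[of w1 n1] by (auto simp: f)
      next
        case (2 w2 n2)
        thus ?thesis
          using u' by (simp add: f)
      qed
    qed
  qed
  moreover have "f u \<noteq> x (lmul m w) n" if "u \<in> verts (colgraph c)" "u \<noteq> x w n" for u
    using that f_verts(2) fx(2) by metis
  ultimately show ?thesis
    unfolding graph_iso_def by (intro exI[of _ f]) (simp add: adj_delete_verts)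
qed

lemma infinite_lmul_image:
  assumes "infinite M" and x: "x = spine \<or> x = twig"
  shows "infinite ((\<lambda>m. x (lmul m w) n) ` M)"
proof -
  have "inj_on (\<lambda>m. x (lmul m w) n) M"
  proof (rule inj_onI)
    fix a b assume "x (lmul a w) n = x (lmul b w) n"
    hence "lmul a w = lmul b w"
      using x by auto
    \<comment> \<open>The length reveals whether a letter was cancelled, and if not, the head is
      that letter; appending \<open>[0]\<close> keeps the head defined for the empty word.\<close>
    hence "length (lmul a w) = length (lmul b w) \<and> hd (lmul a w @ [0]) = hd (lmul b w @ [0])"
      by simp
    thus "a = b"
      using \<open>lmul a w = lmul b w\<close> by (cases w) (auto split: if_splits dest: arg_cong[of _ _ length])
  qed
  thus ?thesis
    using assms(1) by (simp add: finite_image_iff)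
qed

lemma hypomorphic_col: "hypomorphic (colgraph (col False)) (colgraph (col True))"
proof (rule hypomorphicI)
  let ?G = "colgraph (col False)" and ?H = "colgraph (col True)"
  have iso: "graph_iso (delete_verts ?G {x w n}) (delete_verts ?H {x (lmul m w) n})"
    if "distinct_adj w" "flip m = (w, n)" "x = spine \<or> x = twig" for x w n m
  proof (rule graph_iso_delete_lmul[OF _ that(3,1)])
    show "col False w' n' = col True (lmul m w') n'" if "(w', n') \<noteq> (w, n)" for w' n'
      using col_lmul[of False w' n' m] that \<open>flip m = (w, n)\<close> by auto
  qed
  have vert: "x w n \<in> verts (colgraph c) \<longleftrightarrow> distinct_adj w" if "x = spine \<or> x = twig" for x w n c
    using that by auto
  have cases: "\<exists>x w n. (x = spine \<or> x = twig) \<and> distinct_adj w \<and> v = x w n"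
    if "v \<in> verts (colgraph c)" for v c
    using that by (auto elim!: verts_colgraphE)
  show "infinite {w \<in> verts ?H. graph_iso (delete_verts ?G {v}) (delete_verts ?H {w})}"
    if "v \<in> verts ?G" for v
  proof -
    obtain x w n where x: "x = spine \<or> x = twig" and w: "distinct_adj w" "v = x w n"
      using cases[OF \<open>v \<in> verts ?G\<close>] by blast
    have "(\<lambda>m. x (lmul m w) n) ` {m. flip m = (w, n)}
        \<subseteq> {w \<in> verts ?H. graph_iso (delete_verts ?G {v}) (delete_verts ?H {w})}"
      using iso[OF w(1) _ x] vert[OF x] w by auto
    thus ?thesis
      using infinite_lmul_image[OF infinite_flip(1)[OF w(1)] x] finite_subset by blast
  qed
  show "infinite {v \<in> verts ?G. graph_iso (delete_verts ?G {v}) (delete_verts ?H {u})}"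
    if "u \<in> verts ?H" for u
  proof -
    obtain x w n where x: "x = spine \<or> x = twig" and w: "distinct_adj w" "u = x w n"
      using cases[OF \<open>u \<in> verts ?H\<close>] by blast
    \<comment> \<open>Here the place lies over \<open>lmul m w\<close> on the
      \<open>col False\<close> side, and translation by \<open>m\<close> carries it to
      \<open>w\<close>.\<close>
    have "graph_iso (delete_verts ?G {x (lmul m w) n}) (delete_verts ?H {u})"
      if "flip m = (lmul m w, n)" for m
      using iso[of "lmul m w" m n x] that x w by simp
    hence "(\<lambda>m. x (lmul m w) n) ` {m. flip m = (lmul m w, n)}
        \<subseteq> {v \<in> verts ?G. graph_iso (delete_verts ?G {v}) (delete_verts ?H {u})}"
      using vert[OF x] w by auto
    thus ?thesis
      using infinite_lmul_image[OF infinite_flip(2)[OF w(1)] x] finite_subset by blast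
  qed
qed auto

theorem theorem1p5:
  "\<exists>G :: nat ugraph. simple_graph G \<and> connected_graph G \<and> bounded_degree G \<and>
     infinite (ends G) \<and> countable (ends G) \<and> \<not> reconstructible G"
proof (intro exI conjI)
  let ?G = "colgraph (col False)"
  show "simple_graph ?G" by (rule simple_graph_colgraph)
  show "connected_graph ?G" by (rule connected_colgraph)
  show "bounded_degree ?G" by (rule bounded_degree_colgraph)
  show "infinite (ends ?G)" by (rule infinite_ends_colgraph)
  show "countable (ends ?G)" by (rule countable_ends_colgraph)
  show "\<not> reconstructible ?G"
    unfolding reconstructible_def
    using simple_graph_colgraph hypomorphic_col not_graph_iso_col by blast
qed

end
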